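(* Let $\alpha\in\mathbb{R}\setminus\{0\}$, $\beta>0$, and put $n=1$ if $\alpha>0$ and $n=2$ if $\alpha<0$. Let $\mathbf{y}\in\mathbb{T}_{\alpha\beta}^p$, $\mathbf{X}\in\mathbb{T}_{\alpha\beta}^{p\times q}$ with columns $\mathbf{x}(1),\dots,\mathbf{x}(q)$, and let $\mathcal{D}=\{\sum_{i=1}^q\phi_i\mathbf{x}(i):\phi_i\in\mathbb{T}_{\alpha\beta}\}$. Then: 1. There exists a unique projection $\hat{\mathbf{y}}_n$ of $\mathbf{y}$ onto $\mathcal{D}$, i.e. a unique $\hat{\mathbf{y}}_n\in\mathcal{D}$ minimizing $d_n(\mathbf{y},\mathbf{x})=\|\mathbf{y}-\mathbf{x}\|_n$ over $\mathbf{x}\in\mathcal{D}$. 2. An element $\hat{\mathbf{y}}_n\in\mathcal{D}$ is the projection of $\mathbf{y}$ onto $\mathcal{D}$ if and only if $\langle\mathbf{x},\mathbf{y}-\hat{\mathbf{y}}_n\rangle_n=0$ for all $\mathbf{x}\in\mathcal{D}$.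
   Context: $\mathbb{T}_{\alpha\beta}$ (the $(\alpha\beta)$-tessarines) is the commutative, associative real algebra with basis $1,\mathrm{i},\mathrm{j},\mathrm{k}$ and multiplication $\mathrm{i}^2=\alpha$, $\mathrm{j}^2=\beta$, $\mathrm{k}^2=\alpha\beta$, $\mathrm{i}\mathrm{j}=\mathrm{k}$, $\mathrm{i}\mathrm{k}=\alpha\mathrm{j}$, $\mathrm{j}\mathrm{k}=\beta\mathrm{i}$. For $\mathbf{x}=\mathbf{a}+\mathbf{b}\mathrm{i}+\mathbf{c}\mathrm{j}+\mathbf{d}\mathrm{k}$ with real $\mathbf{a},\dots,\mathbf{d}$: $\mathbf{x}^{\mathtt{H}_{1}^{1}}=\mathbf{x}^{\mathtt T}$ and $\mathbf{x}^{\mathtt{H}_{-1}^{1}}=\mathbf{a}^{\mathtt T}-\mathbf{b}^{\mathtt T}\mathrm{i}+\mathbf{c}^{\mathtt T}\mathrm{j}-\mathbf{d}^{\mathtt T}\mathrm{k}$. For vectors, $\langle\mathbf{x},\mathbf{y}\rangle_n=\mathbf{x}^{\mathtt{H}_{3-2n}^1}\mathbf{y}\in\mathbb{T}_{\alpha\beta}$ and $\|\mathbf{x}\|_n=\Re\{\langle\mathbf{x},\mathbf{x}\rangle_n\}^{1/2}$, where $\Re$ is the coefficient of $1$. *)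

theory Defs
  imports "HOL-Analysis.Analysis"
begin

text \<open>
  The underlying real vector space of the tessarines, with coordinates with respect to the basis
  1, i, j, k.  It does not depend on the real parameters \<alpha> and \<beta>; these enter only through the
  multiplication, which therefore takes them as explicit arguments.
\<close>

datatype tessarine = Tess (re: real) (im_i: real) (im_j: real) (im_k: real)

instantiation tessarine :: real_vector
begin

definition "0 = Tess 0 0 0 0"

definition "x + y = Tess (re x + re y) (im_i x + im_i y) (im_j x + im_j y) (im_k x + im_k y)"

definition "x - y = Tess (re x - re y) (im_i x - im_i y) (im_j x - im_j y) (im_k x - im_k y)"

definition "- x = Tess (- re x) (- im_i x) (- im_j x) (- im_k x)"

definition "r *\<^sub>R x = Tess (r * re x) (r * im_i x) (r * im_j x) (r * im_k x)"

instance
  by intro_classes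
    (simp_all add: zero_tessarine_def plus_tessarine_def minus_tessarine_def
      uminus_tessarine_def scaleR_tessarine_def algebra_simps)

end

definition t_one :: tessarine where "t_one = Tess 1 0 0 0"
definition t_i :: tessarine where "t_i = Tess 0 1 0 0"
definition t_j :: tessarine where "t_j = Tess 0 0 1 0"
definition t_k :: tessarine where "t_k = Tess 0 0 0 1"

text \<open>
  The bilinear extension of the multiplication table of the basis; see the lemma
  \<open>tmult_table\<close> below.
\<close>

definition tmult :: "real \<Rightarrow> real \<Rightarrow> tessarine \<Rightarrow> tessarine \<Rightarrow> tessarine" where
  "tmult \<alpha> \<beta> x y = Tess
     (re x * re y + \<alpha> * im_i x * im_i y + \<beta> * im_j x * im_j y + \<alpha> * \<beta> * im_k x * im_k y)
     (re x * im_i y + im_i x * re y + \<beta> * (im_j x * im_k y + im_k x * im_j y))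
     (re x * im_j y + im_j x * re y + \<alpha> * (im_i x * im_k y + im_k x * im_i y))
     (re x * im_k y + im_k x * re y + im_i x * im_j y + im_j x * im_i y)"

lemma tessarine_expand:
  "x = re x *\<^sub>R t_one + im_i x *\<^sub>R t_i + im_j x *\<^sub>R t_j + im_k x *\<^sub>R t_k"
  by (cases x)
    (simp add: t_one_def t_i_def t_j_def t_k_def plus_tessarine_def scaleR_tessarine_def)

lemma tmult_table:
  "tmult \<alpha> \<beta> t_i t_i = \<alpha> *\<^sub>R t_one"
  "tmult \<alpha> \<beta> t_j t_j = \<beta> *\<^sub>R t_one"
  "tmult \<alpha> \<beta> t_k t_k = (\<alpha> * \<beta>) *\<^sub>R t_one"
  "tmult \<alpha> \<beta> t_i t_j = t_k"
  "tmult \<alpha> \<beta> t_i t_k = \<alpha> *\<^sub>R t_j"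
  "tmult \<alpha> \<beta> t_j t_k = \<beta> *\<^sub>R t_i"
  by (simp_all add: tmult_def t_one_def t_i_def t_j_def t_k_def scaleR_tessarine_def)

lemma tmult_one: "tmult \<alpha> \<beta> t_one x = x"
  by (simp add: tmult_def t_one_def)

lemma tmult_commute: "tmult \<alpha> \<beta> x y = tmult \<alpha> \<beta> y x"
  by (simp add: tmult_def algebra_simps)

lemma tmult_assoc: "tmult \<alpha> \<beta> (tmult \<alpha> \<beta> x y) z = tmult \<alpha> \<beta> x (tmult \<alpha> \<beta> y z)"
  by (simp add: tmult_def algebra_simps)

lemma tmult_add_left: "tmult \<alpha> \<beta> (x + y) z = tmult \<alpha> \<beta> x z + tmult \<alpha> \<beta> y z"
  by (simp add: tmult_def plus_tessarine_def algebra_simps)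

lemma tmult_scaleR_left: "tmult \<alpha> \<beta> (r *\<^sub>R x) y = r *\<^sub>R tmult \<alpha> \<beta> x y"
  by (simp add: tmult_def scaleR_tessarine_def algebra_simps)

definition tscale ::
  "real \<Rightarrow> real \<Rightarrow> tessarine \<Rightarrow> tessarine ^ 'p \<Rightarrow> tessarine ^ 'p" where
  "tscale \<alpha> \<beta> \<phi> x = (\<chi> k. tmult \<alpha> \<beta> \<phi> (x $ k))"

text \<open>
  The entrywise map underlying the transposition with lower index \<open>s\<close>, which is only meant for
  \<open>s = 1\<close> (the identity, giving the plain transpose) and \<open>s = -1\<close> (the coefficients of i and k
  change sign, those of 1 and j do not).
\<close>

definition tconj :: "int \<Rightarrow> tessarine \<Rightarrow> tessarine" where
  "tconj s x = Tess (re x) (of_int s * im_i x) (im_j x) (of_int s * im_k x)"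

text \<open>
  The product of the row vector obtained from \<open>x\<close> and the column vector \<open>y\<close>.  The index \<open>3 - 2n\<close>
  is 1 for \<open>n = 1\<close> and -1 for \<open>n = 2\<close>; no other \<open>n\<close> is used.
\<close>

definition tprod ::
  "real \<Rightarrow> real \<Rightarrow> nat \<Rightarrow> tessarine ^ 'p \<Rightarrow> tessarine ^ 'p \<Rightarrow> tessarine" where
  "tprod \<alpha> \<beta> n x y = (\<Sum>k\<in>UNIV. tmult \<alpha> \<beta> (tconj (3 - 2 * int n) (x $ k)) (y $ k))"

definition tnorm :: "real \<Rightarrow> real \<Rightarrow> nat \<Rightarrow> tessarine ^ 'p \<Rightarrow> real" where
  "tnorm \<alpha> \<beta> n x = sqrt (re (tprod \<alpha> \<beta> n x x))"

definition tdist :: "real \<Rightarrow> real \<Rightarrow> nat \<Rightarrow> tessarine ^ 'p \<Rightarrow> tessarine ^ 'p \<Rightarrow> real" where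
  "tdist \<alpha> \<beta> n x y = tnorm \<alpha> \<beta> n (x - y)"

definition column_module ::
  "real \<Rightarrow> real \<Rightarrow> tessarine ^ 'q ^ 'p \<Rightarrow> (tessarine ^ 'p) set" where
  "column_module \<alpha> \<beta> X =
     {\<Sum>i\<in>UNIV. tscale \<alpha> \<beta> (\<phi> i) (column i X) | \<phi> :: 'q \<Rightarrow> tessarine. True}"

definition is_projection ::
  "real \<Rightarrow> real \<Rightarrow> nat \<Rightarrow> (tessarine ^ 'p) set \<Rightarrow> tessarine ^ 'p \<Rightarrow> tessarine ^ 'p \<Rightarrow> bool" where
  "is_projection \<alpha> \<beta> n D y z \<longleftrightarrow>
     z \<in> D \<and> (\<forall>x\<in>D. tdist \<alpha> \<beta> n y z \<le> tdist \<alpha> \<beta> n y x)"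

end

theory Submission
  imports Defs
begin

text \<open>
  For the prescribed \<open>n\<close> we have \<open>(3 - 2n) \<alpha> = \<bar>\<alpha>\<bar>\<close>, so the real part of the product is the inner
  product with weights \<open>1, \<bar>\<alpha>\<bar>, \<beta>, \<bar>\<alpha>\<bar>\<beta>\<close>, and rescaling the coordinates embeds the tessarine vectors
  isometrically into a Euclidean space.  There the real subspace \<open>\<D>\<close> has an orthogonal projection,
  which is the unique minimizer.  Finally, real orthogonality to \<open>\<D>\<close> gives full orthogonality, since
  \<open>\<D>\<close> is closed under multiplication by 1, i, j, k and the real parts of the multiples
  of a tessarine by these are its coordinates up to nonzero factors.
\<close>

section \<open>Orthogonal projection through an embedding\<close>

lemma projection_through_embedding:
  fixes e :: "'a::real_vector \<Rightarrow> 'b::euclidean_space"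
  assumes e: "linear e" "inj e" and S: "subspace S"
  obtains z where "z \<in> S"
    and "\<And>w. w \<in> S \<Longrightarrow> (\<forall>x\<in>S. e x \<bullet> e (y - w) = 0) \<longleftrightarrow> w = z"
    and "\<And>w. w \<in> S \<Longrightarrow> (\<forall>x\<in>S. norm (e (y - w)) \<le> norm (e (y - x))) \<longleftrightarrow> w = z"
proof -
  have "subspace (e ` S)"
    using e(1) S by (rule linear_subspace_image)
  obtain u v where u: "u \<in> span (e ` S)" and v: "\<And>w. w \<in> span (e ` S) \<Longrightarrow> orthogonal v w"
    and y: "e y = u + v"
    by (rule orthogonal_subspace_decomp_exists) blast
  obtain z where z: "z \<in> S" "u = e z"
    using u \<open>subspace (e ` S)\<close> by (metis imageE span_eq_iff)
  have ort: "e x \<bullet> e (y - z) = 0" if "x \<in> S" for x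
    using v[of "e x"] that y z(2) linear_diff[OF e(1)]
    by (simp add: orthogonal_def inner_commute span_base)
  have pyth: "(norm (e (y - w)))\<^sup>2 = (norm (e (y - z)))\<^sup>2 + (norm (e (z - w)))\<^sup>2"
    if "w \<in> S" for w
  proof -
    have "e (y - w) = e (y - z) + e (z - w)"
      by (simp flip: linear_add[OF e(1)])
    moreover have "orthogonal (e (y - z)) (e (z - w))"
      using ort[of "z - w"] S z(1) that
      by (simp add: orthogonal_def inner_commute subspace_diff)
    ultimately show ?thesis
      by (simp add: norm_add_Pythagorean)
  qed
  have eq0: "w = z" if "e (z - w) = 0" for w
    using that e by (metis eq_iff_diff_eq_0 linear_injective_0)
  show thesis
  proof (rule that[OF z(1)])
    fix w assume w: "w \<in> S"
    show "(\<forall>x\<in>S. e x \<bullet> e (y - w) = 0) \<longleftrightarrow> w = z"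
    proof
      assume *: "\<forall>x\<in>S. e x \<bullet> e (y - w) = 0"
      have zw: "z - w \<in> S"
        using S z(1) w by (rule subspace_diff)
      \<comment> \<open>Both residuals are orthogonal to the image of \<open>S\<close>, hence so is
        their difference, which itself lies in that image. It is therefore orthogonal to
        itself.\<close>
      have "e (z - w) = e (y - w) - e (y - z)"
        by (simp flip: linear_diff[OF e(1)])
      then have "e (z - w) \<bullet> e (z - w) = e (z - w) \<bullet> e (y - w) - e (z - w) \<bullet> e (y - z)"
        by (metis inner_diff_right)
      also have "\<dots> = 0"
        using * ort zw by simp
      finally show "w = z"
        by (simp add: eq0)
    qed (use ort in blast)
    show "(\<forall>x\<in>S. norm (e (y - w)) \<le> norm (e (y - x))) \<longleftrightarrow> w = z"
    proof
      assume "\<forall>x\<in>S. norm (e (y - w)) \<le> norm (e (y - x))"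
      \<comment> \<open>Competing against \<open>z\<close> itself leaves no room for the extra term
        in \<open>pyth\<close>.\<close>
      then have "(norm (e (y - w)))\<^sup>2 \<le> (norm (e (y - z)))\<^sup>2"
        using z(1) by simp
      then show "w = z"
        using pyth[OF w] eq0 by simp
    next
      assume "w = z"
      show "\<forall>x\<in>S. norm (e (y - w)) \<le> norm (e (y - x))"
      proof
        fix x assume "x \<in> S"
        then have "(norm (e (y - z)))\<^sup>2 \<le> (norm (e (y - x)))\<^sup>2"
          using pyth by simp
        then show "norm (e (y - w)) \<le> norm (e (y - x))"
          unfolding \<open>w = z\<close> by (rule power2_le_imp_le) simp
      qed
    qed
  qed
qed

section \<open>Tessarine vectors\<close>

lemma tess_sel_simps [simp]:
  "re 0 = 0" "im_i 0 = 0" "im_j 0 = 0" "im_k 0 = 0"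
  "re (x + y) = re x + re y" "im_i (x + y) = im_i x + im_i y"
  "im_j (x + y) = im_j x + im_j y" "im_k (x + y) = im_k x + im_k y"
  "re (r *\<^sub>R x) = r * re x" "im_i (r *\<^sub>R x) = r * im_i x"
  "im_j (r *\<^sub>R x) = r * im_j x" "im_k (r *\<^sub>R x) = r * im_k x"
  by (simp_all add: zero_tessarine_def plus_tessarine_def scaleR_tessarine_def)

lemma tmult_add_right: "tmult \<alpha> \<beta> z (x + y) = tmult \<alpha> \<beta> z x + tmult \<alpha> \<beta> z y"
  by (metis tmult_add_left tmult_commute)

lemma tmult_zero [simp]: "tmult \<alpha> \<beta> 0 x = 0" "tmult \<alpha> \<beta> x 0 = 0"
  by (simp_all add: tmult_def zero_tessarine_def)

lemma tmult_sum_right: "tmult \<alpha> \<beta> z (\<Sum>i\<in>I. f i) = (\<Sum>i\<in>I. tmult \<alpha> \<beta> z (f i))"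
  by (induction I rule: infinite_finite_induct) (simp_all add: tmult_add_right)

lemma tscale_add_left: "tscale \<alpha> \<beta> (\<phi> + \<psi>) x = tscale \<alpha> \<beta> \<phi> x + tscale \<alpha> \<beta> \<psi> x"
  by (simp add: tscale_def vec_eq_iff tmult_add_left)

lemma tscale_scaleR_left: "tscale \<alpha> \<beta> (r *\<^sub>R \<phi>) x = r *\<^sub>R tscale \<alpha> \<beta> \<phi> x"
  by (simp add: tscale_def vec_eq_iff tmult_scaleR_left)

lemma tscale_zero_left: "tscale \<alpha> \<beta> 0 x = 0"
  by (simp add: tscale_def vec_eq_iff)

lemma tscale_tscale: "tscale \<alpha> \<beta> \<phi> (tscale \<alpha> \<beta> \<psi> x) = tscale \<alpha> \<beta> (tmult \<alpha> \<beta> \<phi> \<psi>) x"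
  by (simp add: tscale_def vec_eq_iff tmult_assoc)

lemma tscale_sum_right: "tscale \<alpha> \<beta> \<phi> (\<Sum>i\<in>I. f i) = (\<Sum>i\<in>I. tscale \<alpha> \<beta> \<phi> (f i))"
  by (simp add: tscale_def vec_eq_iff tmult_sum_right)

lemma column_moduleI: "(\<Sum>i\<in>UNIV. tscale \<alpha> \<beta> (\<phi> i) (column i X)) \<in> column_module \<alpha> \<beta> X"
  by (auto simp: column_module_def)

lemma column_moduleE:
  assumes "x \<in> column_module \<alpha> \<beta> X"
  obtains \<phi> where "x = (\<Sum>i\<in>UNIV. tscale \<alpha> \<beta> (\<phi> i) (column i X))"
  using assms by (auto simp: column_module_def)

lemma subspace_column_module: "subspace (column_module \<alpha> \<beta> X)"
proof (rule subspaceI)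
  show "0 \<in> column_module \<alpha> \<beta> X"
    using column_moduleI[of \<alpha> \<beta> "\<lambda>_. 0" X] by (simp add: tscale_zero_left)
next
  fix x y assume "x \<in> column_module \<alpha> \<beta> X" "y \<in> column_module \<alpha> \<beta> X"
  then obtain \<phi> \<psi> where "x = (\<Sum>i\<in>UNIV. tscale \<alpha> \<beta> (\<phi> i) (column i X))"
    and "y = (\<Sum>i\<in>UNIV. tscale \<alpha> \<beta> (\<psi> i) (column i X))"
    by (auto elim!: column_moduleE)
  then have "x + y = (\<Sum>i\<in>UNIV. tscale \<alpha> \<beta> (\<phi> i + \<psi> i) (column i X))"
    by (simp add: tscale_add_left sum.distrib)
  then show "x + y \<in> column_module \<alpha> \<beta> X"
    using column_moduleI[of \<alpha> \<beta> "\<lambda>i. \<phi> i + \<psi> i" X] by simp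
next
  fix r x assume "x \<in> column_module \<alpha> \<beta> X"
  then obtain \<phi> where "x = (\<Sum>i\<in>UNIV. tscale \<alpha> \<beta> (\<phi> i) (column i X))"
    by (rule column_moduleE)
  then have "r *\<^sub>R x = (\<Sum>i\<in>UNIV. tscale \<alpha> \<beta> (r *\<^sub>R \<phi> i) (column i X))"
    by (simp add: tscale_scaleR_left scaleR_right.sum)
  then show "r *\<^sub>R x \<in> column_module \<alpha> \<beta> X"
    using column_moduleI[of \<alpha> \<beta> "\<lambda>i. r *\<^sub>R \<phi> i" X] by simp
qed

lemma tscale_column_module:
  assumes "x \<in> column_module \<alpha> \<beta> X"
  shows "tscale \<alpha> \<beta> \<psi> x \<in> column_module \<alpha> \<beta> X"
proof -
  obtain \<phi> where "x = (\<Sum>i\<in>UNIV. tscale \<alpha> \<beta> (\<phi> i) (column i X))"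
    using assms by (rule column_moduleE)
  then have "tscale \<alpha> \<beta> \<psi> x = (\<Sum>i\<in>UNIV. tscale \<alpha> \<beta> (tmult \<alpha> \<beta> \<psi> (\<phi> i)) (column i X))"
    by (simp add: tscale_sum_right tscale_tscale)
  then show ?thesis
    using column_moduleI[of \<alpha> \<beta> "\<lambda>i. tmult \<alpha> \<beta> \<psi> (\<phi> i)" X] by simp
qed

section \<open>The product and its real part\<close>

text \<open>The algebra is graded with 1 and j even, i and k odd. Changing the sign of the odd part
  is thus an automorphism.\<close>

lemma tconj_tmult:
  assumes "s\<^sup>2 = 1"
  shows "tconj s (tmult \<alpha> \<beta> x y) = tmult \<alpha> \<beta> (tconj s x) (tconj s y)"
proof -
  have "s = 1 \<or> s = -1"
    using assms by (simp add: power2_eq_1_iff)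
  then show ?thesis
    by (auto simp: tconj_def tmult_def algebra_simps)
qed

lemma tconj_tconj: "s\<^sup>2 = 1 \<Longrightarrow> tconj s (tconj s x) = x"
  by (cases x) (auto simp: tconj_def power2_eq_1_iff)

text \<open>The assumption says that \<open>n\<close> is 1 or 2, so that conjugation is
  multiplicative and the scalar leaves the sum conjugated.\<close>

lemma tprod_tscale_left:
  assumes "(3 - 2 * int n)\<^sup>2 = 1"
  shows "tprod \<alpha> \<beta> n (tscale \<alpha> \<beta> \<phi> x) y =
    tmult \<alpha> \<beta> (tconj (3 - 2 * int n) \<phi>) (tprod \<alpha> \<beta> n x y)"
  using assms by (simp add: tprod_def tscale_def tconj_tmult tmult_assoc tmult_sum_right)

text \<open>Taking 1, i, j, k for \<phi> yields the coordinates of \<open>t\<close> times 1,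
  \<alpha>, \<beta>, \<alpha>\<beta>: the bilinear form given by the real part of the product is
  nondegenerate.\<close>

lemma re_tmult_eq_0_imp_eq_0:
  assumes "\<alpha> \<noteq> 0" "\<beta> \<noteq> 0" and "\<And>\<phi>. re (tmult \<alpha> \<beta> \<phi> t) = 0"
  shows "t = 0"
  using assms(3)[of t_one] assms(3)[of t_i] assms(3)[of t_j] assms(3)[of t_k] assms(1,2)
  by (cases t) (simp add: tmult_def t_one_def t_i_def t_j_def t_k_def zero_tessarine_def)

lemma re_sum: "re (\<Sum>i\<in>I. f i) = (\<Sum>i\<in>I. re (f i))"
  by (induction I rule: infinite_finite_induct) simp_all

text \<open>The factors are the square roots of the weights of the real inner product. The absolute
  value keeps them real for negative \<alpha>.\<close>

definition tembed :: "real \<Rightarrow> real \<Rightarrow> tessarine ^ 'p \<Rightarrow> (real \<times> real \<times> real \<times> real) ^ 'p" where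
  "tembed \<alpha> \<beta> x = (\<chi> k. (re (x $ k), sqrt \<bar>\<alpha>\<bar> * im_i (x $ k), sqrt \<beta> * im_j (x $ k),
     sqrt (\<bar>\<alpha>\<bar> * \<beta>) * im_k (x $ k)))"

lemma linear_tembed: "linear (tembed \<alpha> \<beta>)"
  by (rule linearI) (simp_all add: tembed_def vec_eq_iff algebra_simps)

lemma inj_tembed:
  assumes "\<alpha> \<noteq> 0" "\<beta> > 0"
  shows "inj (tembed \<alpha> \<beta> :: tessarine ^ 'p \<Rightarrow> _)"
proof (rule injI)
  fix x y :: "tessarine ^ 'p"
  assume "tembed \<alpha> \<beta> x = tembed \<alpha> \<beta> y"
  then have "re (x $ k) = re (y $ k) \<and> im_i (x $ k) = im_i (y $ k) \<and>
      im_j (x $ k) = im_j (y $ k) \<and> im_k (x $ k) = im_k (y $ k)" for k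
    using assms by (simp add: tembed_def vec_eq_iff)
  then show "x = y"
    by (simp add: vec_eq_iff tessarine.expand)
qed

text \<open>The second assumption makes the sign from the conjugation cancel that of \<alpha> in the
  i and k terms, the only ones in which either occurs.\<close>

lemma tembed_inner:
  assumes "\<beta> > 0" "real_of_int (3 - 2 * int n) * \<alpha> = \<bar>\<alpha>\<bar>"
  shows "tembed \<alpha> \<beta> x \<bullet> tembed \<alpha> \<beta> y = re (tprod \<alpha> \<beta> n x y)"
proof -
  have sq: "sqrt c * a * (sqrt c * b) = c * a * b" if "c \<ge> 0" for a b c :: real
    using that by (metis mult.assoc mult.left_commute real_sqrt_mult_self abs_of_nonneg)
  have "re (tmult \<alpha> \<beta> (tconj (3 - 2 * int n) u) v) =
    re u * re v + \<bar>\<alpha>\<bar> * im_i u * im_i v + \<beta> * im_j u * im_j v + \<bar>\<alpha>\<bar> * \<beta> * im_k u * im_k v"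
    for u v
    unfolding assms(2)[symmetric] by (simp add: tmult_def tconj_def algebra_simps)
  moreover have "\<bar>\<alpha>\<bar> * \<beta> \<ge> 0"
    using assms(1) by simp
  ultimately show ?thesis
    using assms(1)
    by (simp add: tembed_def tprod_def re_sum inner_vec_def sq)
       (simp add: add.assoc)
qed

theorem theorem9:
  fixes \<alpha> \<beta> :: real and n :: nat
    and y :: "tessarine ^ 'p" and X :: "tessarine ^ 'q ^ 'p"
  assumes "\<alpha> \<noteq> 0" and "\<beta> > 0"
    and "n = (if \<alpha> > 0 then 1 else 2)"
  shows "(\<exists>!z. is_projection \<alpha> \<beta> n (column_module \<alpha> \<beta> X) y z) \<and>
    (\<forall>z \<in> column_module \<alpha> \<beta> X.
      is_projection \<alpha> \<beta> n (column_module \<alpha> \<beta> X) y z \<longleftrightarrow>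
      (\<forall>x \<in> column_module \<alpha> \<beta> X. tprod \<alpha> \<beta> n x (y - z) = 0))"
proof -
  define D where "D = column_module \<alpha> \<beta> X"
  define s where "s = 3 - 2 * int n"
  \<comment> \<open>The choice of \<open>n\<close> makes \<open>s\<close> the sign of
    \<alpha>.\<close>
  have s: "s\<^sup>2 = 1" and s\<alpha>: "real_of_int s * \<alpha> = \<bar>\<alpha>\<bar>"
    using assms by (auto simp: s_def)
  have inner: "tembed \<alpha> \<beta> u \<bullet> tembed \<alpha> \<beta> v = re (tprod \<alpha> \<beta> n u v)" for u v :: "tessarine ^ 'p"
    using tembed_inner[OF assms(2)] s\<alpha> unfolding s_def by blast
  have tdist: "tdist \<alpha> \<beta> n u v = norm (tembed \<alpha> \<beta> (u - v))" for u v :: "tessarine ^ 'p"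
    by (simp add: tdist_def tnorm_def norm_eq_sqrt_inner inner)
  obtain z where z: "z \<in> D"
    and ort: "\<And>w. w \<in> D \<Longrightarrow> (\<forall>x\<in>D. tembed \<alpha> \<beta> x \<bullet> tembed \<alpha> \<beta> (y - w) = 0) \<longleftrightarrow> w = z"
    and min: "\<And>w. w \<in> D \<Longrightarrow>
      (\<forall>x\<in>D. norm (tembed \<alpha> \<beta> (y - w)) \<le> norm (tembed \<alpha> \<beta> (y - x))) \<longleftrightarrow> w = z"
    using projection_through_embedding[OF linear_tembed inj_tembed[OF assms(1,2)],
        of D y] subspace_column_module unfolding D_def by blast
  have proj: "is_projection \<alpha> \<beta> n D y w \<longleftrightarrow> w = z" for w
    unfolding is_projection_def tdist using min z by blast
  have "(\<forall>x\<in>D. re (tprod \<alpha> \<beta> n x v) = 0) \<longleftrightarrow> (\<forall>x\<in>D. tprod \<alpha> \<beta> n x v = 0)" for v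
  proof (intro iffI ballI)
    fix x assume *: "\<forall>x\<in>D. re (tprod \<alpha> \<beta> n x v) = 0" and x: "x \<in> D"
    show "tprod \<alpha> \<beta> n x v = 0"
    proof (rule re_tmult_eq_0_imp_eq_0[OF assms(1)])
      fix \<phi>
      \<comment> \<open>The product conjugates scalars in its first argument, so scaling by the
        conjugate of \<phi> brings out \<phi> itself.\<close>
      have "tscale \<alpha> \<beta> (tconj s \<phi>) x \<in> D"
        using x unfolding D_def by (rule tscale_column_module)
      moreover have "tprod \<alpha> \<beta> n (tscale \<alpha> \<beta> (tconj s \<phi>) x) v = tmult \<alpha> \<beta> \<phi> (tprod \<alpha> \<beta> n x v)"
        using s by (simp add: s_def tprod_tscale_left tconj_tconj)
      ultimately show "re (tmult \<alpha> \<beta> \<phi> (tprod \<alpha> \<beta> n x v)) = 0"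
        using * by metis
    qed (use assms(2) in simp)
  qed simp
  then have "(\<forall>x\<in>D. tprod \<alpha> \<beta> n x (y - w) = 0) \<longleftrightarrow> w = z" if "w \<in> D" for w
    using ort[OF that] by (simp add: inner)
  then show ?thesis
    unfolding D_def[symmetric] by (simp add: proj)
qed

end
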